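(* Let $L,q\ge1$ be integers, $p=2^Lq$, and let $\mathcal{A}\in\mathbb{R}^{m\times n\times p}$. Then the Moore-Penrose inverse of $\mathcal{A}$ under the $w$-product exists and is unique; that is, there exists exactly one tensor $\mathcal{X}\in\mathbb{R}^{n\times m\times p}$ satisfying $$\mathcal{A}\star_w\mathcal{X}\star_w\mathcal{A}=\mathcal{A},\quad \mathcal{X}\star_w\mathcal{A}\star_w\mathcal{X}=\mathcal{X},\quad (\mathcal{A}\star_w\mathcal{X})^\top=\mathcal{A}\star_w\mathcal{X},\quad (\mathcal{X}\star_w\mathcal{A})^\top=\mathcal{X}\star_w\mathcal{A}.$$
   Context: For a real third-order tensor $\mathcal{A}\in\mathbb{R}^{n_1\times n_2\times p}$ with $p=2^Lq$, $L,q\ge1$ integers, $\mathcal{A}[:,:,k]$ denotes its $k$-th frontal slice. Wavelet transform (lazy wavelet, along the third dimension): put $\mathcal{A}_{s_0}=\mathcal{A}$ and, for $j=1,\dots,L$ and $k=1,\dots,p/2^j$, $$\mathcal{A}_{d_j}[:,:,k]=\mathcal{A}_{s_{j-1}}[:,:,2k-1]-\mathcal{A}_{s_{j-1}}[:,:,2k],\qquad \mathcal{A}_{s_j}[:,:,k]=\mathcal{A}_{s_{j-1}}[:,:,2k]+\tfrac12\mathcal{A}_{d_j}[:,:,k].$$ Then $W_{[L]}(\mathcal{A})=(\mathcal{A}_{s_L},\mathcal{A}_{d_L},\dots,\mathcal{A}_{d_1})$; here $\mathcal{A}_{s_L}$ has $q$ frontal slices and $\mathcal{A}_{d_j}$ has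 $p/2^j$. The map $W_{[L]}$ is invertible, with inverse $W_{[L]}^{-1}$ computed for $j=L,\dots,1$ by $\mathcal{A}_{s_{j-1}}[:,:,2k]=\mathcal{A}_{s_j}[:,:,k]-\tfrac12\mathcal{A}_{d_j}[:,:,k]$ and $\mathcal{A}_{s_{j-1}}[:,:,2k-1]=\mathcal{A}_{d_j}[:,:,k]+\mathcal{A}_{s_{j-1}}[:,:,2k]$. The $w$-product of $\mathcal{A}\in\mathbb{R}^{n_1\times n_2\times p}$ and $\mathcal{B}\in\mathbb{R}^{n_2\times n_3\times p}$ is $\mathcal{A}\star_w\mathcal{B}=W_{[L]}^{-1}(W_{[L]}(\mathcal{A})\,\Delta\,W_{[L]}(\mathcal{B}))\in\mathbb{R}^{n_1\times n_3\times p}$, where the face-product $\Delta$ multiplies corresponding frontal slices of corresponding components as matrices. The transpose is $\mathcal{A}^\top[i,j,:]=\mathcal{A}[j,i,:]$. Triple products are unambiguous since $\star_w$ is associative. *)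

theory Defs
  imports "HOL-Analysis.Analysis"
begin

text \<open>
  A real tensor of size \<open>n1 \<times> n2 \<times> p\<close> is the list of its \<open>p\<close> frontal slices, each an
  \<open>n1 \<times> n2\<close> matrix. The first two dimensions are index types, the third one is the length
  of the list.
\<close>

type_synonym ('n1, 'n2) tensor = "(real ^ 'n2 ^ 'n1) list"

definition tensors :: "nat \<Rightarrow> ('n1::finite, 'n2::finite) tensor set"
  where "tensors p = {A. length A = p}"

text \<open>Slices are numbered from 1.\<close>

definition slice :: "('n1::finite, 'n2::finite) tensor \<Rightarrow> nat \<Rightarrow> real ^ 'n2 ^ 'n1"
  where "slice A k = A ! (k - 1)"

definition detail_step :: "('n1::finite, 'n2::finite) tensor \<Rightarrow> ('n1, 'n2) tensor"
  where "detail_step S =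
    map (\<lambda>k. slice S (2 * k - 1) - slice S (2 * k)) [1..<length S div 2 + 1]"

definition approx_step :: "('n1::finite, 'n2::finite) tensor \<Rightarrow> ('n1, 'n2) tensor"
  where "approx_step S =
    map (\<lambda>k. slice S (2 * k) + (1 / 2) *\<^sub>R slice (detail_step S) k) [1..<length S div 2 + 1]"

text \<open>\<open>approx A j\<close> is $A_{s_j}$ and, for \<open>j \<ge> 1\<close>, \<open>detail A j\<close> is $A_{d_j}$.\<close>

primrec approx :: "('n1::finite, 'n2::finite) tensor \<Rightarrow> nat \<Rightarrow> ('n1, 'n2) tensor"
  where
    "approx A 0 = A"
  | "approx A (Suc j) = approx_step (approx A j)"

definition detail :: "('n1::finite, 'n2::finite) tensor \<Rightarrow> nat \<Rightarrow> ('n1, 'n2) tensor"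
  where "detail A j = detail_step (approx A (j - 1))"

text \<open>The transform is the list of components $[A_{s_L}, A_{d_L}, \ldots, A_{d_1}]$.\<close>

definition wavelet :: "nat \<Rightarrow> ('n1::finite, 'n2::finite) tensor \<Rightarrow> ('n1, 'n2) tensor list"
  where "wavelet L A = approx A L # map (detail A) (rev [1..<L + 1])"

text \<open>
  One step of the inverse transform recovers $A_{s_{j-1}}$ from $A_{s_j}$ and $A_{d_j}$; each
  \<open>k\<close> contributes the slices \<open>2 * k - 1\<close> and \<open>2 * k\<close>, in this order.
\<close>

definition inverse_step ::
    "('n1::finite, 'n2::finite) tensor \<Rightarrow> ('n1, 'n2) tensor \<Rightarrow> ('n1, 'n2) tensor"
  where "inverse_step S D =
    concat (map (\<lambda>k. let even_slice = slice S k - (1 / 2) *\<^sub>R slice D k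
                     in [slice D k + even_slice, even_slice]) [1..<length S + 1])"

definition inverse_wavelet :: "('n1::finite, 'n2::finite) tensor list \<Rightarrow> ('n1, 'n2) tensor"
  where "inverse_wavelet C = foldl inverse_step (hd C) (tl C)"

definition face_product ::
    "('n1::finite, 'n2::finite) tensor list \<Rightarrow> ('n2, 'n3::finite) tensor list
      \<Rightarrow> ('n1, 'n3) tensor list"
  where "face_product C D = map2 (map2 (\<lambda>M N. M ** N)) C D"

definition wprod ::
    "nat \<Rightarrow> ('n1::finite, 'n2::finite) tensor \<Rightarrow> ('n2, 'n3::finite) tensor \<Rightarrow> ('n1, 'n3) tensor"
  where "wprod L A B = inverse_wavelet (face_product (wavelet L A) (wavelet L B))"

definition tensor_transpose :: "('n1::finite, 'n2::finite) tensor \<Rightarrow> ('n2, 'n1) tensor"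
  where "tensor_transpose A = map transpose A"

end

theory Submission imports Defs begin

text \<open>
  The wavelet transform is a bijection onto the coefficient lists of the appropriate shape, and it
  turns the \<open>w\<close>-product into the slicewise matrix product. It is moreover linear with scalar
  coefficients, so it commutes with transposition. Hence the four Penrose equations hold for
  tensors iff they hold for each pair of corresponding slices of the transforms, and the theorem
  reduces to existence and uniqueness of the Moore-Penrose inverse of a real matrix.
\<close>

section \<open>Moore-Penrose inverses of real matrices\<close>

definition is_pinv :: "real ^ 'n ^ 'm \<Rightarrow> real ^ 'm ^ 'n \<Rightarrow> bool"
  where "is_pinv A X \<longleftrightarrow> A ** X ** A = A \<and> X ** A ** X = X
    \<and> transpose (A ** X) = A ** X \<and> transpose (X ** A) = X ** A"

text \<open>\<open>A ** X\<close> and \<open>A ** Y\<close> are symmetric and, because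
  \<open>A ** X ** A = A = A ** Y ** A\<close>, each absorbs the other from the left; transposing
  one absorption gives their equality. \<open>X ** A\<close> and \<open>Y ** A\<close> are treated
  in the same way.\<close>

lemma is_pinv_unique:
  fixes A :: "real ^ 'n ^ 'm"
  assumes X: "is_pinv A X" and Y: "is_pinv A Y"
  shows "X = Y"
proof -
  have "A ** X = A ** Y ** (A ** X)"
    using Y by (metis is_pinv_def matrix_mul_assoc)
  also have "\<dots> = transpose (A ** X ** (A ** Y))"
    using X Y by (simp add: is_pinv_def matrix_transpose_mul)
  also have "\<dots> = A ** Y"
    using X Y by (metis is_pinv_def matrix_mul_assoc)
  finally have AX: "A ** X = A ** Y" .
  have "X ** A = X ** A ** (Y ** A)"
    using Y by (metis is_pinv_def matrix_mul_assoc)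
  also have "\<dots> = transpose (Y ** A ** (X ** A))"
    using X Y by (simp add: is_pinv_def matrix_transpose_mul)
  also have "\<dots> = Y ** A"
    using X Y by (metis is_pinv_def matrix_mul_assoc)
  finally have XA: "X ** A = Y ** A" .
  \<comment> \<open>X = XAX = XAY = YAY = Y.\<close>
  show ?thesis
    using X Y AX XA by (metis is_pinv_def matrix_mul_assoc)
qed

text \<open>Split b = y + z with y in the range of A and z orthogonal to it. Then A^T z = 0, so any
  preimage x of y works.\<close>

lemma normal_equation_solvable:
  fixes A :: "real ^ 'n ^ 'm"
  shows "\<exists>x. transpose A *v (A *v x) = transpose A *v b"
proof -
  let ?S = "range ((*v) A)"
  have S: "subspace ?S"
    by (simp add: linear_subspace_image)
  obtain y z where y: "y \<in> span ?S" and z: "\<And>w. w \<in> span ?S \<Longrightarrow> orthogonal z w" and b: "b = y + z"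
    using orthogonal_subspace_decomp_exists by blast
  obtain x where x: "y = A *v x"
    using y S by (auto simp: span_eq_iff[THEN iffD2])
  have "(transpose A *v z) \<bullet> w = 0" for w
    using z[of "A *v w"] S
    by (simp add: span_eq_iff[THEN iffD2] orthogonal_def dot_lmul_matrix transpose_matrix_vector)
  then have "transpose A *v z = 0"
    using inner_eq_zero_iff by blast
  then have "transpose A *v (A *v x) = transpose A *v b"
    by (simp add: b x matrix_vector_right_distrib)
  then show ?thesis ..
qed

text \<open>Solving the normal equations for all unit vectors gives X with A^T A X = A^T, hence X^T
  A^T A = A. Expanding (A X)^T = X^T A^T by the first identity and contracting by the second yields
  A X.\<close>

lemma least_squares_inverse_exists:
  fixes A :: "real ^ 'n ^ 'm"
  shows "\<exists>X. A ** X ** A = A \<and> transpose (A ** X) = A ** X"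
proof -
  obtain x where x: "\<And>b. transpose A *v (A *v x b) = transpose A *v b"
    using normal_equation_solvable[of A] by metis
  \<comment> \<open>The chosen solutions are the rows of the inner matrix, so the transpose has them
    as columns.\<close>
  define X where "X = transpose (\<chi> j. x (axis j 1))"
  have "column j (transpose A ** A ** X) = column j (transpose A)" for j
  proof -
    have "X *v axis j 1 = x (axis j 1)"
      by (simp add: X_def matrix_vector_mul_component vec_eq_iff matrix_vector_mult_basis
          column_def transpose_def)
    then have "(transpose A ** A ** X) *v axis j 1 = transpose A *v axis j 1"
      using x[of "axis j 1"] by (simp flip: matrix_vector_mul_assoc)
    then show ?thesis
      by (simp only: matrix_vector_mult_basis)
  qed
  then have normal: "transpose A ** A ** X = transpose A"
    by (simp add: column_def vec_eq_iff)
  have A: "transpose X ** transpose A ** A = A"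
    using arg_cong[OF normal, of transpose] by (simp add: matrix_transpose_mul matrix_mul_assoc)
  have "transpose (A ** X) = transpose X ** (transpose A ** A ** X)"
    by (simp add: normal matrix_transpose_mul)
  also have "\<dots> = A ** X"
    by (simp add: matrix_mul_assoc A)
  finally have sym: "transpose (A ** X) = A ** X" .
  have "A ** X ** A = A"
    using A sym by (simp add: matrix_transpose_mul)
  with sym show ?thesis by blast
qed

text \<open>X makes A X symmetric; the transpose Y of such an inverse of A^T makes Y A symmetric.
  The product Y A X has both properties, since A (Y A X) = A X and (Y A X) A = Y A.\<close>

lemma is_pinv_exists:
  fixes A :: "real ^ 'n ^ 'm"
  shows "\<exists>X. is_pinv A X"
proof -
  obtain X where X: "A ** X ** A = A" "transpose (A ** X) = A ** X"
    using least_squares_inverse_exists by blast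
  obtain Z where Z: "transpose A ** Z ** transpose A = transpose A"
      "transpose (transpose A ** Z) = transpose A ** Z"
    using least_squares_inverse_exists by blast
  define Y where "Y = transpose Z"
  have Y: "A ** Y ** A = A" "transpose (Y ** A) = Y ** A"
    using arg_cong[OF Z(1), of transpose] Z(2)
    by (simp_all add: Y_def matrix_transpose_mul matrix_mul_assoc)
  have "A ** (Y ** A ** X) = A ** X" "Y ** A ** X ** A = Y ** A"
    using X Y by (metis matrix_mul_assoc)+
  then have "is_pinv A (Y ** A ** X)"
    unfolding is_pinv_def using X Y by (metis matrix_mul_assoc)
  then show ?thesis by blast
qed

section \<open>Inversion of the wavelet transform\<close>

lemma length_detail_step [simp]: "length (detail_step S) = length S div 2"
  by (simp add: detail_step_def)

lemma length_approx_step [simp]: "length (approx_step S) = length S div 2"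
  by (simp add: approx_step_def)

text \<open>From here on indices are zero-based: the slices 2k - 1 and 2k of the definition, taken
  at k + 1, sit at positions 2k and 2k + 1.\<close>

lemma nth_detail_step [simp]:
  "k < length S div 2 \<Longrightarrow> detail_step S ! k = S ! (2 * k) - S ! (2 * k + 1)"
  by (simp add: detail_step_def slice_def nth_upt del: upt_Suc)

lemma nth_approx_step [simp]:
  "k < length S div 2 \<Longrightarrow>
    approx_step S ! k = S ! (2 * k + 1) + (1 / 2) *\<^sub>R (S ! (2 * k) - S ! (2 * k + 1))"
  by (simp add: approx_step_def slice_def nth_upt del: upt_Suc)

lemma length_concat_map_pair [simp]: "length (concat (map (\<lambda>k. [f k, g k]) ks)) = 2 * length ks"
  by (induction ks) auto

lemma nth_concat_map_pair:
  assumes "k < length ks"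
  shows "concat (map (\<lambda>k. [f k, g k]) ks) ! (2 * k) = f (ks ! k)"
    and "concat (map (\<lambda>k. [f k, g k]) ks) ! Suc (2 * k) = g (ks ! k)"
  using assms
proof (induction ks arbitrary: k)
  case (Cons a ks)
  { case 1 then show ?case using Cons by (cases k) auto }
  { case 2 then show ?case using Cons by (cases k) auto }
qed auto

lemma length_inverse_step [simp]: "length (inverse_step S D) = 2 * length S"
  by (simp add: inverse_step_def Let_def del: upt_Suc)

lemma nth_inverse_step [simp]:
  assumes "k < length S"
  shows "inverse_step S D ! (2 * k) = D ! k + (S ! k - (1 / 2) *\<^sub>R D ! k)"
    and "inverse_step S D ! Suc (2 * k) = S ! k - (1 / 2) *\<^sub>R D ! k"
  using assms
  by (simp_all add: inverse_step_def Let_def slice_def nth_concat_map_pair nth_upt del: upt_Suc)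

text \<open>Evenness ensures that halving the length drops no last slice.\<close>

lemma inverse_step_approx_detail:
  assumes "even (length S)"
  shows "inverse_step (approx_step S) (detail_step S) = S"
proof (rule nth_equalityI)
  fix i assume "i < length (inverse_step (approx_step S) (detail_step S))"
  then have *: "i div 2 < length S div 2" by auto
  show "inverse_step (approx_step S) (detail_step S) ! i = S ! i"
  proof (cases "even i")
    case True
    then obtain k where "i = 2 * k" ..
    with * show ?thesis by simp
  next
    case False
    then obtain k where "i = 2 * k + 1" ..
    with * show ?thesis by simp
  qed
qed (use assms in auto)

lemma approx_step_inverse_step: "approx_step (inverse_step S D) = S"
  by (rule nth_equalityI) auto

lemma detail_step_inverse_step: "length D = length S \<Longrightarrow> detail_step (inverse_step S D) = D"
  by (rule nth_equalityI) auto

lemma approx_Suc_shift: "approx A (Suc j) = approx (approx_step A) j"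
  by (induction j) auto

lemma wavelet_0 [simp]: "wavelet 0 A = [A]"
  by (simp add: wavelet_def)

text \<open>Peels off the first, finest step instead of the last one. Its detail is the final
  component, which \<open>foldl\<close> consumes last, so transform and inverse can be matched by
  induction on \<open>L\<close>.\<close>

lemma wavelet_Suc: "wavelet (Suc L) A = wavelet L (approx_step A) @ [detail_step A]"
proof -
  have "rev [1..<Suc L + 1] = map Suc (rev [1..<L + 1]) @ [1]"
    by (simp add: rev_map[symmetric] map_Suc_upt upt_conv_Cons del: upt_Suc)
  moreover have "detail A (Suc j) = detail (approx_step A) j" if "j \<ge> 1" for j
    using that approx_Suc_shift[of A "j - 1"] by (cases j) (simp_all add: detail_def)
  ultimately show ?thesis
    by (simp add: wavelet_def approx_Suc_shift detail_def[of _ "Suc 0"] del: upt_Suc approx.simps(2))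
qed

lemma inverse_wavelet_singleton [simp]: "inverse_wavelet [S] = S"
  by (simp add: inverse_wavelet_def)

lemma inverse_wavelet_snoc:
  "C \<noteq> [] \<Longrightarrow> inverse_wavelet (C @ [D]) = inverse_step (inverse_wavelet C) D"
  by (cases C) (simp_all add: inverse_wavelet_def)

text \<open>The component lengths of a transform, in the order $s_L, d_L, \ldots, d_1$.\<close>

definition shape :: "nat \<Rightarrow> nat \<Rightarrow> nat list"
  where "shape L q = q # map (\<lambda>i. 2 ^ i * q) [0..<L]"

lemma shape_0 [simp]: "shape 0 q = [q]"
  by (simp add: shape_def)

lemma shape_Suc [simp]: "shape (Suc L) q = shape L q @ [2 ^ L * q]"
  by (simp add: shape_def)

lemma wavelet_shape: "length A = 2 ^ L * q \<Longrightarrow> map length (wavelet L A) = shape L q"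
  by (induction L arbitrary: A) (simp_all add: wavelet_Suc)

lemma wavelet_not_Nil [simp]: "wavelet L A \<noteq> []"
  by (simp add: wavelet_def)

lemma inverse_wavelet_wavelet: "length A = 2 ^ L * q \<Longrightarrow> inverse_wavelet (wavelet L A) = A"
  by (induction L arbitrary: A)
    (simp_all add: wavelet_Suc inverse_wavelet_snoc inverse_step_approx_detail)

text \<open>The right-inverse half. In the induction the last component has exactly the length of
  the tensor rebuilt from the others, so one inverse step can be undone.\<close>

lemma wavelet_inverse_wavelet:
  assumes "map length C = shape L q"
  shows "length (inverse_wavelet C) = 2 ^ L * q" and "wavelet L (inverse_wavelet C) = C"
proof -
  have "length (inverse_wavelet C) = 2 ^ L * q \<and> wavelet L (inverse_wavelet C) = C"
    using assms
  proof (induction L arbitrary: C)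
    case 0
    then show ?case by (auto simp: map_eq_Cons_conv)
  next
    case (Suc L)
    then obtain C' D where C: "C = C' @ [D]" "map length C' = shape L q" "length D = 2 ^ L * q"
      by (auto simp: map_eq_append_conv map_eq_Cons_conv)
    then have "C' \<noteq> []"
      by (auto simp: shape_def)
    with C Suc.IH[OF C(2)] show ?case
      by (simp add: inverse_wavelet_snoc wavelet_Suc approx_step_inverse_step
          detail_step_inverse_step)
  qed
  then show "length (inverse_wavelet C) = 2 ^ L * q" "wavelet L (inverse_wavelet C) = C"
    by blast+
qed

lemma wavelet_inject:
  assumes "length A = 2 ^ L * q" "length B = 2 ^ L * q"
  shows "wavelet L A = wavelet L B \<longleftrightarrow> A = B"
  using assms inverse_wavelet_wavelet by metis

section \<open>Transposition and product in the wavelet domain\<close>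

lemma approx_step_transpose: "approx_step (tensor_transpose S) = tensor_transpose (approx_step S)"
  by (rule nth_equalityI) (auto simp: tensor_transpose_def transpose_def vec_eq_iff)

lemma detail_step_transpose: "detail_step (tensor_transpose S) = tensor_transpose (detail_step S)"
  by (rule nth_equalityI) (auto simp: tensor_transpose_def transpose_def vec_eq_iff)

lemma wavelet_transpose: "wavelet L (tensor_transpose A) = map tensor_transpose (wavelet L A)"
  by (induction L arbitrary: A)
    (simp_all add: wavelet_Suc approx_step_transpose detail_step_transpose)

lemma length_tensor_transpose [simp]: "length (tensor_transpose A) = length A"
  by (simp add: tensor_transpose_def)

text \<open>\<open>map2\<close> truncates to the shorter list; equal shapes exclude this both for
  the components and for the slices within them.\<close>

lemma face_product_shape:
  assumes "map length C = s" "map length D = s"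
  shows "map length (face_product C D) = s"
proof -
  have len: "length C = length s" "length D = length s"
    using assms by (metis length_map)+
  have "length (C ! i) = s ! i" "length (D ! i) = s ! i" if "i < length s" for i
    using assms that len by (metis nth_map)+
  then show ?thesis
    using len by (intro nth_equalityI) (auto simp: face_product_def)
qed

text \<open>The face product of two transforms again has the shape of a transform, so
  \<open>wavelet\<close> cancels the \<open>inverse_wavelet\<close> in \<open>wprod\<close>.\<close>

lemma wprod_wavelet:
  assumes "length A = 2 ^ L * q" "length B = 2 ^ L * q"
  shows "length (wprod L A B) = 2 ^ L * q"
    and "wavelet L (wprod L A B) = face_product (wavelet L A) (wavelet L B)"
  using assms unfolding wprod_def
  by (simp_all add: wavelet_inverse_wavelet face_product_shape wavelet_shape)

text \<open>The Penrose equations as they appear after the transform, where transposition acts on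
  every component.\<close>

definition is_face_pinv :: "('m::finite, 'n::finite) tensor list \<Rightarrow> ('n, 'm) tensor list \<Rightarrow> bool"
  where "is_face_pinv C D \<longleftrightarrow> face_product (face_product C D) C = C
    \<and> face_product (face_product D C) D = D
    \<and> map tensor_transpose (face_product C D) = face_product C D
    \<and> map tensor_transpose (face_product D C) = face_product D C"

text \<open>Used to break each Penrose equation between coefficient lists into one matrix equation
  per slice.\<close>

lemma nested_list_eq_iff:
  assumes "map length C = map length D"
  shows "C = D \<longleftrightarrow> (\<forall>i < length C. \<forall>j < length (C ! i). C ! i ! j = D ! i ! j)"
proof -
  have "length C = length D"
    using assms map_eq_imp_length_eq by blast
  moreover have "length (C ! i) = length (D ! i)" if "i < length C" for i
    using assms that calculation by (metis nth_map)
  ultimately show ?thesis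
    by (auto simp: list_eq_iff_nth_eq)
qed

lemma is_face_pinv_iff:
  assumes "map length C = map length D"
  shows "is_face_pinv C D \<longleftrightarrow>
    (\<forall>i < length C. \<forall>j < length (C ! i). is_pinv (C ! i ! j) (D ! i ! j))"
proof -
  have l: "length D = length C"
    using assms map_eq_imp_length_eq by metis
  have l': "length (D ! i) = length (C ! i)" if "i < length C" for i
    using assms that l by (metis nth_map)
  have s: "map length (face_product C D) = map length C" "map length (face_product D C) = map length C"
    "map length (face_product (face_product C D) C) = map length C"
    "map length (face_product (face_product D C) D) = map length D"
    using assms by (simp_all add: face_product_shape)
  have t: "map length (map tensor_transpose (face_product C D)) = map length (face_product C D)"
    "map length (map tensor_transpose (face_product D C)) = map length (face_product D C)"
    by simp_all
  show ?thesis
    unfolding is_face_pinv_def is_pinv_def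
      nested_list_eq_iff[OF s(3)] nested_list_eq_iff[OF s(4)] nested_list_eq_iff[OF t(1)] nested_list_eq_iff[OF t(2)]
    by (auto simp: face_product_def tensor_transpose_def l l')
qed

lemma is_face_pinv_exists:
  fixes C :: "('m::finite, 'n::finite) tensor list"
  shows "\<exists>D. map length D = map length C \<and> is_face_pinv C D"
proof -
  obtain f where f: "\<And>M :: real ^ 'n ^ 'm. is_pinv M (f M)"
    using is_pinv_exists by metis
  have "is_face_pinv C (map (map f) C)"
    by (subst is_face_pinv_iff) (auto simp: f)
  then show ?thesis
    by (intro exI[of _ "map (map f) C"]) auto
qed

lemma is_face_pinv_unique:
  assumes "map length D = map length C" "map length E = map length C"
    and "is_face_pinv C D" "is_face_pinv C E"
  shows "D = E"
proof -
  have "length D = length C"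
    using assms(1) map_eq_imp_length_eq by blast
  moreover from this have "length (D ! i) = length (C ! i)" if "i < length C" for i
    using assms(1) that by (metis nth_map)
  ultimately show ?thesis
    using assms by (subst nested_list_eq_iff) (simp_all add: is_face_pinv_iff, metis is_pinv_unique)
qed

theorem theorem2p6:
  fixes A :: "('m::finite, 'n::finite) tensor" and L q p :: nat
  assumes "L \<ge> 1" and "q \<ge> 1" and "p = 2 ^ L * q"
    and "A \<in> tensors p"
  shows "\<exists>!X :: ('n, 'm) tensor. X \<in> tensors p
    \<and> wprod L (wprod L A X) A = A
    \<and> wprod L (wprod L X A) X = X
    \<and> tensor_transpose (wprod L A X) = wprod L A X
    \<and> tensor_transpose (wprod L X A) = wprod L X A"
    (is "\<exists>!X. ?P X")
proof -
  have A: "length A = 2 ^ L * q"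
    using assms by (simp add: tensors_def)
  \<comment> \<open>All tensors involved have length 2^L q, so injectivity of the transform replaces
    each equation by the one between transforms.\<close>
  have P: "?P X \<longleftrightarrow> length X = 2 ^ L * q \<and> is_face_pinv (wavelet L A) (wavelet L X)" for X
  proof (cases "length X = 2 ^ L * q")
    case True
    with A show ?thesis
      by (simp add: is_face_pinv_def tensors_def assms(3) wprod_wavelet wavelet_transpose
          flip: wavelet_inject[of _ L q])
  qed (simp add: tensors_def assms(3))
  show ?thesis
    unfolding P
  proof (rule ex_ex1I)
    \<comment> \<open>\<open>D\<close> has the shape of a transform and is therefore the transform
      of \<open>inverse_wavelet D\<close>.\<close>
    obtain D where D: "map length D = shape L q" "is_face_pinv (wavelet L A) D"
      using is_face_pinv_exists wavelet_shape[OF A] by metis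
    then show "\<exists>X. length X = 2 ^ L * q \<and> is_face_pinv (wavelet L A) (wavelet L X)"
      using wavelet_inverse_wavelet[OF D(1)] by (intro exI[of _ "inverse_wavelet D"]) simp
  next
    fix X Y
    assume X: "length X = 2 ^ L * q \<and> is_face_pinv (wavelet L A) (wavelet L X)"
      and Y: "length Y = 2 ^ L * q \<and> is_face_pinv (wavelet L A) (wavelet L Y)"
    then have "wavelet L X = wavelet L Y"
      using A by (intro is_face_pinv_unique[of _ "wavelet L A"]) (simp_all add: wavelet_shape)
    with X Y show "X = Y"
      using wavelet_inject by blast
  qed
qed

end
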